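(* Let $\mathbf{A}\in\mathbb{R}^{n\times n}$, $\mathbf{b}\in\mathbb{R}^n$, let $\mathbf{x}^*$ be the exact solution of $\mathbf{A}\mathbf{x}=\mathbf{b}$, $\mathbf{M}=\mathbf{I}-\mathbf{A}$, and $q(\mathbf{x})=\mathbf{M}\mathbf{x}+\mathbf{b}$. Assume that $\|\mathbf{M}\|=c<1$. Then, for any initial guess $\mathbf{x}_0\in\mathbb{R}^n$, the aAA($m$)[$s$]--FP[$t$] method applied to the fixed-point iteration $\mathbf{x}_{k+1}=q(\mathbf{x}_k)$ converges, i.e. $\mathbf{x}_k\to\mathbf{x}^*$ as $k\to\infty$.
   Context: $\|\cdot\|$ is the Euclidean norm and the induced matrix norm. The residual function is $r(\mathbf{x})=q(\mathbf{x})-\mathbf{x}=\mathbf{b}-\mathbf{A}\mathbf{x}$. Anderson step: given $\mathbf{x}_0,\dots,\mathbf{x}_k$ and a window size $m\in\{0,1,2,\dots\}\cup\{\infty\}$, put $m_k=\min\{m,k\}$. The AA($m$) update is $$\mathbf{x}_{k+1}=q(\mathbf{x}_k)+\sum_{i=1}^{m_k}\gamma_i^{(k)}\bigl(q(\mathbf{x}_k)-q(\mathbf{x}_{k-i})\bigr),$$ where $(\gamma_1^{(k)},\dots,\gamma_{m_k}^{(k)})\in\mathbb{R}^{m_k}$ is a minimizer of $\bigl\|r(\mathbf{x}_k)+\sum_{i=1}^{m_k}\gamma_i\,(r(\mathbf{x}_k)-r(\mathbf{x}_{k-i}))\bigr\|^2$. The method aAA($m$)[$s$]--FP[$t$] (integers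 $s\ge1$, $t\ge0$) starts from $\mathbf{x}_0$, and for each $k\ge 0$: if $k \bmod (s+t)<t$, then $\mathbf{x}_{k+1}=q(\mathbf{x}_k)$ (fixed-point step); otherwise $\mathbf{x}_{k+1}$ is the AA($m$) update. Thus it repeats $t$ fixed-point steps followed by $s$ Anderson steps; the history used by an Anderson step consists of all preceding iterates within the window, whether produced by fixed-point or Anderson steps. *)

theory Defs
  imports "HOL-Analysis.Analysis" "HOL-Library.Extended_Nat"
begin

definition residual :: "('a \<Rightarrow> 'a) \<Rightarrow> 'a \<Rightarrow> 'a::real_normed_vector" where
  "residual q x = q x - x"

definition window :: "enat \<Rightarrow> nat \<Rightarrow> nat" where
  "window m k = the_enat (min m (enat k))"

text \<open>
  A coefficient vector with \<open>window m k\<close> entries is represented by a function on \<open>nat\<close>;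
  only its values on \<open>{1..window m k}\<close> matter.
\<close>

definition aa_objective ::
    "('a::real_normed_vector \<Rightarrow> 'a) \<Rightarrow> enat \<Rightarrow> (nat \<Rightarrow> 'a) \<Rightarrow> nat \<Rightarrow> (nat \<Rightarrow> real) \<Rightarrow> real" where
  "aa_objective q m x k \<gamma> =
     (norm (residual q (x k) +
        (\<Sum>i=1..window m k. \<gamma> i *\<^sub>R (residual q (x k) - residual q (x (k - i))))))\<^sup>2"

text \<open>
  The least-squares minimizer need not be unique, so a step of the method is a relation:
  the next iterate may come from any minimizer.
\<close>

definition is_aa_step ::
    "('a::real_normed_vector \<Rightarrow> 'a) \<Rightarrow> enat \<Rightarrow> (nat \<Rightarrow> 'a) \<Rightarrow> nat \<Rightarrow> bool" where
  "is_aa_step q m x k \<longleftrightarrow>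
     (\<exists>\<gamma>. is_arg_min (aa_objective q m x k) (\<lambda>_. True) \<gamma> \<and>
          x (Suc k) = q (x k) + (\<Sum>i=1..window m k. \<gamma> i *\<^sub>R (q (x k) - q (x (k - i)))))"

definition is_fp_step :: "('a \<Rightarrow> 'a) \<Rightarrow> (nat \<Rightarrow> 'a) \<Rightarrow> nat \<Rightarrow> bool" where
  "is_fp_step q x k \<longleftrightarrow> x (Suc k) = q (x k)"

definition is_aAA_FP ::
    "('a::real_normed_vector \<Rightarrow> 'a) \<Rightarrow> enat \<Rightarrow> nat \<Rightarrow> nat \<Rightarrow> (nat \<Rightarrow> 'a) \<Rightarrow> bool" where
  "is_aAA_FP q m s t x \<longleftrightarrow>
     (\<forall>k. if k mod (s + t) < t then is_fp_step q x k else is_aa_step q m x k)"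

end

theory Submission
  imports Defs
begin

text \<open>
  Since \<open>q\<close> is affine, an Anderson update is \<open>q y\<close> with \<open>y\<close> an extrapolation of the iterates,
  and the least-squares objective is exactly the squared residual norm at \<open>y\<close>. Comparing with
  zero coefficients, the residual at \<open>y\<close> is no larger than at the current iterate, and
  applying \<open>q\<close> multiplies it by \<open>M\<close>. So every step, of either kind, contracts
  the residual by the factor \<open>c\<close>, and the error is at most \<open>1 / (1 - c)\<close> times the residual.
\<close>

text \<open>The weights of \<open>z\<close> and of the \<open>w i\<close> sum to 1, and
  \<open>b\<close> cancels in each difference \<open>g z - g (w i)\<close>. Stated for a general
  affine \<open>g\<close> because it is applied both to \<open>q\<close> and to
  \<open>residual q\<close>.\<close>

lemma affine_extrapolation:
  fixes g :: "'a::real_vector \<Rightarrow> 'b::real_vector"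
  assumes "linear f" and "\<And>y. g y = f y + b"
  shows "g (z + (\<Sum>i\<in>I. \<gamma> i *\<^sub>R (z - w i))) = g z + (\<Sum>i\<in>I. \<gamma> i *\<^sub>R (g z - g (w i)))"
  using assms by (simp add: linear_add linear_sum linear_scale linear_diff)

lemma norm_residual_affine:
  assumes f: "bounded_linear f" and q: "q = (\<lambda>y. f y + b)"
  shows "norm (residual q (q y)) \<le> onorm f * norm (residual q y)"
proof -
  have "residual q (q y) = f (residual q y)"
    by (simp add: residual_def q linear_simps[OF f])
  then show ?thesis
    using onorm[OF f] by metis
qed

lemma aa_step_residual_le:
  assumes f: "bounded_linear f" and q: "q = (\<lambda>y. f y + b)"
    and step: "is_aa_step q m x k"
  shows "norm (residual q (x (Suc k))) \<le> onorm f * norm (residual q (x k))"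
proof -
  obtain \<gamma> where min: "is_arg_min (aa_objective q m x k) (\<lambda>_. True) \<gamma>"
    and upd: "x (Suc k) = q (x k) + (\<Sum>i=1..window m k. \<gamma> i *\<^sub>R (q (x k) - q (x (k - i))))"
    using step unfolding is_aa_step_def by blast
  define y where "y = x k + (\<Sum>i=1..window m k. \<gamma> i *\<^sub>R (x k - x (k - i)))"
  have lin: "linear f"
    using f by (rule bounded_linear.linear)
  have "x (Suc k) = q y"
    unfolding upd y_def by (rule affine_extrapolation[symmetric, OF lin]) (simp add: q)
  moreover have "residual q y = residual q (x k) +
      (\<Sum>i=1..window m k. \<gamma> i *\<^sub>R (residual q (x k) - residual q (x (k - i))))"
    unfolding y_def
    \<comment> \<open>The residual is itself affine: linear part \<open>f\<close> minus the
      identity, same constant \<open>b\<close>.\<close>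
    by (rule affine_extrapolation[where f = "\<lambda>y. f y - y" and b = b])
       (auto simp: residual_def q intro!: linear_compose_sub lin linear_ident)
  then have "aa_objective q m x k \<gamma> = (norm (residual q y))\<^sup>2"
    by (simp add: aa_objective_def)
  moreover have "aa_objective q m x k \<gamma> \<le> aa_objective q m x k (\<lambda>_. 0)"
    using min by (auto simp: is_arg_min_def not_less)
  ultimately have "norm (residual q y) \<le> norm (residual q (x k))"
    by (simp add: aa_objective_def)
  then have "onorm f * norm (residual q y) \<le> onorm f * norm (residual q (x k))"
    by (intro mult_left_mono onorm_pos_le[OF f])
  with norm_residual_affine[OF f q, of y] \<open>x (Suc k) = q y\<close> show ?thesis
    by simp
qed

lemma aAA_FP_residual_le:
  assumes f: "bounded_linear f" and q: "q = (\<lambda>y. f y + b)"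
    and x: "is_aAA_FP q m s t x"
  shows "norm (residual q (x k)) \<le> onorm f ^ k * norm (residual q (x 0))"
proof (induction k)
  case 0
  show ?case by simp
next
  case (Suc k)
  \<comment> \<open>Both kinds of step contract by the same factor, so the position in the cycle
    need not be tracked.\<close>
  have "is_fp_step q x k \<or> is_aa_step q m x k"
    using x unfolding is_aAA_FP_def by metis
  then have "norm (residual q (x (Suc k))) \<le> onorm f * norm (residual q (x k))"
    using aa_step_residual_le[OF f q] norm_residual_affine[OF f q]
    by (auto simp: is_fp_step_def)
  also have "\<dots> \<le> onorm f * (onorm f ^ k * norm (residual q (x 0)))"
    by (intro mult_left_mono Suc.IH onorm_pos_le[OF f])
  finally show ?case by (simp add: mult.assoc)
qed

text \<open>At a fixed point \<open>z\<close> we have \<open>b = z - f z\<close>, so the residual is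
  \<open>f\<close> minus the identity applied to the error; the triangle inequality then bounds it
  from below. Division waits until \<open>onorm f < 1\<close> is available.\<close>

lemma norm_error_le_residual:
  assumes f: "bounded_linear f" and q: "q = (\<lambda>y. f y + b)"
    and "q z = z"
  shows "(1 - onorm f) * norm (y - z) \<le> norm (residual q y)"
proof -
  have "residual q y = f (y - z) - (y - z)"
    using \<open>q z = z\<close> by (simp add: residual_def q linear_simps[OF f] algebra_simps)
  then have "norm (y - z) \<le> norm (f (y - z)) + norm (residual q y)"
    by (metis norm_triangle_sub norm_minus_commute)
  also have "\<dots> \<le> onorm f * norm (y - z) + norm (residual q y)"
    using onorm[OF f] by simp
  finally show ?thesis by (simp add: algebra_simps)
qed

lemma aAA_FP_tendsto:
  assumes f: "bounded_linear f" and q: "q = (\<lambda>y. f y + b)"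
    and "onorm f < 1" and "q z = z" and x: "is_aAA_FP q m s t x"
  shows "x \<longlonglongrightarrow> z"
proof (rule LIM_zero_cancel, rule Lim_null_comparison)
  let ?B = "\<lambda>k. onorm f ^ k * norm (residual q (x 0)) / (1 - onorm f)"
  have "norm (x k - z) \<le> ?B k" for k
  proof -
    have "(1 - onorm f) * norm (x k - z) \<le> onorm f ^ k * norm (residual q (x 0))"
      using norm_error_le_residual[OF f q \<open>q z = z\<close>] aAA_FP_residual_le[OF f q x]
      by (rule order_trans)
    then show ?thesis
      using \<open>onorm f < 1\<close> by (simp add: field_simps)
  qed
  then show "\<forall>\<^sub>F k in sequentially. norm (x k - z) \<le> ?B k"
    by simp
  have "(\<lambda>k. onorm f ^ k) \<longlonglongrightarrow> 0"
    \<comment> \<open>The power limit needs the absolute value of \<open>onorm f\<close> below 1,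
      hence nonnegativity as well.\<close>
    using onorm_pos_le[OF f] \<open>onorm f < 1\<close> by (intro LIMSEQ_power_zero) simp
  then show "?B \<longlonglongrightarrow> 0"
    by (intro tendsto_divide_zero tendsto_mult_left_zero)
qed

theorem theorem2:
  fixes A M :: "real ^ 'n ^ 'n" and b xstar x0 :: "real ^ 'n"
    and q :: "real ^ 'n \<Rightarrow> real ^ 'n" and c :: real
    and m :: enat and s t :: nat and x :: "nat \<Rightarrow> real ^ 'n"
  assumes "A *v xstar = b"
    and "M = mat 1 - A"
    and "q = (\<lambda>y. M *v y + b)"
    and "onorm (\<lambda>y. M *v y) = c" and "c < 1"
    and "s \<ge> 1"
    and "x 0 = x0" and "is_aAA_FP q m s t x"
  shows "x \<longlonglongrightarrow> xstar"
proof (rule aAA_FP_tendsto)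
  show "bounded_linear (\<lambda>y. M *v y)"
    by (rule matrix_vector_mul_bounded_linear)
  \<comment> \<open>\<open>q xstar = xstar - A *v xstar + b\<close>, and the last two terms
    cancel.\<close>
  show "q xstar = xstar"
    using assms(1-3) by (simp add: matrix_vector_mult_diff_rdistrib)
qed (use assms in auto)

end
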